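(* Let $\mathcal{S}$ be an arbitrary semiring. Let $\mathcal{X},\mathcal{Y}\subset\mathcal{S}^n$ and $\mathcal{Z}\subset\mathcal{S}^p$ be rational semimodules. Then $\mathcal{X}\oplus\mathcal{Y}=\{x\oplus y\mid x\in\mathcal{X},y\in\mathcal{Y}\}\subset\mathcal{S}^n$ and $\mathcal{X}\times\mathcal{Z}\subset\mathcal{S}^{n+p}$ are rational semimodules.
   Context: A semiring $(\mathcal{S},\oplus,\otimes,\varepsilon,e)$ has a commutative monoid addition $\oplus$ with neutral element $\varepsilon$, a (not necessarily commutative) monoid multiplication $\otimes$ with neutral element $e$, multiplication distributes over addition, and $\varepsilon$ is absorbing for $\otimes$. The free semimodule $\mathcal{S}^n$ has entrywise addition and left action $(\lambda x)_i=\lambda\otimes x_i$. A subsemimodule of $\mathcal{S}^n$ is a (nonempty) subset $\mathcal{Z}$ with $\lambda x\oplus\mu y\in\mathcal{Z}$ for all $x,y\in\mathcal{Z}$, $\lambda,\mu\in\mathcal{S}$. For $G\subset\mathcal{S}^n$, $\mathrm{span}\,G$ is the subsemimodule generated by $G$, i.e. the set of finite linear combinations $\bigoplus_{i=1}^k\lambda_iu^i$ with $u^i\in G$, $\lambda_i\in\mathcal{S}$ (an empty sum is the zero vector). The class of rational subsets of a monoid $(M,\cdot)$ with unit $1_M$ is the least class of subsets of $M$ that contains all finite subsets and is closed under union, product $U\cdot V=\{u\cdot v\mid u\in U,v\in V\}$, and star $U^*=U^0\cup U\cup U^2\cup\cdots$, where $U^0=\{1_M\}$. A subsemimodule $\mathcal{X}\subset\mathcal{S}^n$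 is rational ("a rational semimodule") if $\mathcal{X}=\mathrm{span}\,G$ for some rational subset $G$ of the monoid $(\mathcal{S}^n,\otimes)$, where $\otimes$ is the entrywise product. *)

theory Defs
  imports "HOL-Analysis.Finite_Cartesian_Product" "HOL-Library.Set_Algebras"
begin

(* The sort {semiring_0, monoid_mult} is used instead of semiring_1 because the class
   semiring_1 also demands 0 \<noteq> 1, which would exclude the one-element semiring.
   On 'a ^ 'n the library operations + and * are entrywise, and c *s x is the left action. *)

definition subsemimodule :: "('a::{semiring_0, monoid_mult} ^ 'n) set \<Rightarrow> bool" where
  "subsemimodule Z \<longleftrightarrow>
     Z \<noteq> {} \<and> (\<forall>x\<in>Z. \<forall>y\<in>Z. \<forall>l m. l *s x + m *s y \<in> Z)"

(* The library's span is only available over commutative rings. *)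
definition semimodule_span ::
    "('a::{semiring_0, monoid_mult} ^ 'n) set \<Rightarrow> ('a ^ 'n) set" where
  "semimodule_span G = {\<Sum>i<k. l i *s u i | (k::nat) l u. \<forall>i<k. u i \<in> G}"

(* Products and powers of sets are the elementwise ones of Set_Algebras; U ^ 0 = {1}. *)
inductive rational_subset :: "'m::monoid_mult set \<Rightarrow> bool" where
  rational_finite: "finite U \<Longrightarrow> rational_subset U"
| rational_union: "rational_subset U \<Longrightarrow> rational_subset V \<Longrightarrow> rational_subset (U \<union> V)"
| rational_product: "rational_subset U \<Longrightarrow> rational_subset V \<Longrightarrow> rational_subset (U * V)"
| rational_star: "rational_subset U \<Longrightarrow> rational_subset (\<Union>k::nat. U ^ k)"

definition rational_semimodule :: "('a::{semiring_0, monoid_mult} ^ 'n) set \<Rightarrow> bool" where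
  "rational_semimodule X \<longleftrightarrow>
     subsemimodule X \<and> (\<exists>G. rational_subset G \<and> X = semimodule_span G)"

(* The identification of pairs from S^n and S^p with vectors in S^(n+p). *)
definition vec_append :: "'a ^ 'n \<Rightarrow> 'a ^ 'p \<Rightarrow> 'a ^ ('n + 'p)" where
  "vec_append x z = (\<chi> i. case i of Inl j \<Rightarrow> x $ j | Inr k \<Rightarrow> z $ k)"

end

theory Submission
  imports Defs
begin

text \<open>If \<open>X\<close>, \<open>Y\<close>, \<open>Z\<close> are spanned by \<open>G\<close>, \<open>H\<close>, \<open>K\<close>, then \<open>X + Y\<close> is spanned by \<open>G \<union> H\<close>, and
  \<open>X \<times> Z\<close> is the sum of the linear images \<open>X \<times> {0}\<close> and \<open>{0} \<times> Z\<close>. The map \<open>x \<mapsto> (x, 0)\<close> does not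
  preserve the unit of the entrywise product, but \<open>x \<mapsto> (x, 1)\<close> does, and monoid morphisms preserve
  rationality; multiplying by the singleton \<open>{(1, 0)}\<close> then gives that \<open>G \<times> {0}\<close> is rational.\<close>

section \<open>Rational subsets under monoid morphisms\<close>

lemma image_set_power:
  fixes f :: "'m::monoid_mult \<Rightarrow> 'k::monoid_mult"
  assumes "f 1 = 1" and mult: "\<And>x y. f (x * y) = f x * f y"
  shows "f ` (U ^ k) = (f ` U) ^ k"
proof (induction k)
  case 0
  then show ?case using \<open>f 1 = 1\<close> by (simp add: set_one)
next
  case (Suc k)
  have "f ` (U * U ^ k) = f ` U * f ` (U ^ k)"
    by (force simp: set_times_def mult)
  then show ?case using Suc by simp
qed

text \<open>Rule induction: taking images preserves finiteness and commutes with union, product and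
  star. The hypothesis \<open>f 1 = 1\<close> enters in the star case, where
  \<open>U ^ 0 = {1}\<close> must be sent to \<open>{1}\<close>.\<close>

lemma rational_subset_image:
  fixes f :: "'m::monoid_mult \<Rightarrow> 'k::monoid_mult"
  assumes "rational_subset U" and one: "f 1 = 1" and mult: "\<And>x y. f (x * y) = f x * f y"
  shows "rational_subset (f ` U)"
  using assms(1)
proof induction
  case (rational_finite U)
  then show ?case by (simp add: rational_subset.rational_finite)
next
  case (rational_union U V)
  then show ?case by (simp add: image_Un rational_subset.rational_union)
next
  case (rational_product U V)
  have "f ` (U * V) = f ` U * f ` V"
    by (force simp: set_times_def mult)
  with rational_product show ?case by (simp add: rational_subset.rational_product)
next
  case (rational_star U)
  then show ?case
    by (simp add: image_UN image_set_power[of f, OF one mult] rational_subset.rational_star)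
qed

section \<open>Left action, subsemimodules and spans\<close>

lemma smult_add_right:
  fixes x y :: "'a::semiring_0 ^ 'n"
  shows "c *s (x + y) = c *s x + c *s y"
  by (simp add: vec_eq_iff distrib_left)

lemma smult_smult:
  fixes x :: "'a::semiring_0 ^ 'n"
  shows "a *s (b *s x) = (a * b) *s x"
  by (simp add: vec_eq_iff mult.assoc)

lemma smult_zero_left:
  fixes x :: "'a::semiring_0 ^ 'n"
  shows "0 *s x = 0"
  by (simp add: vec_eq_iff)

lemma smult_one:
  fixes x :: "'a::{semiring_0, monoid_mult} ^ 'n"
  shows "1 *s x = x"
  by (simp add: vec_eq_iff)

lemma smult_sum:
  fixes u :: "'i \<Rightarrow> 'a::semiring_0 ^ 'n"
  shows "c *s (\<Sum>i\<in>I. u i) = (\<Sum>i\<in>I. c *s u i)"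
  by (simp add: vec_eq_iff sum_distrib_left)

text \<open>Nonemptiness gives some \<open>x\<close> in \<open>Z\<close>, and
  \<open>0 *s x + 0 *s x = 0\<close>.\<close>

lemma subsemimodule_zero: "subsemimodule Z \<Longrightarrow> 0 \<in> Z"
  unfolding subsemimodule_def by (metis add_0 ex_in_conv smult_zero_left)

lemma subsemimodule_smult: "subsemimodule Z \<Longrightarrow> x \<in> Z \<Longrightarrow> c *s x \<in> Z"
  unfolding subsemimodule_def by (metis add.right_neutral smult_zero_left)

lemma subsemimodule_add: "subsemimodule Z \<Longrightarrow> x \<in> Z \<Longrightarrow> y \<in> Z \<Longrightarrow> x + y \<in> Z"
  unfolding subsemimodule_def by (metis smult_one)

text \<open>Induction on the number of summands. Later inclusions of spans thereby reduce to a check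
  on generators.\<close>

lemma semimodule_span_minimal:
  assumes "subsemimodule Z" "G \<subseteq> Z"
  shows "semimodule_span G \<subseteq> Z"
proof -
  have "(\<Sum>i<k. l i *s u i) \<in> Z" if "\<forall>i<k. u i \<in> G" for k :: nat and l u
    using that
    by (induction k) (use assms in \<open>auto intro!: subsemimodule_zero subsemimodule_add
      subsemimodule_smult\<close>)
  then show ?thesis by (auto simp: semimodule_span_def)
qed

text \<open>Prepares closure of the span under addition: the second combination is absorbed one term
  at a time, which avoids shifting its indices past those of the first.\<close>

lemma semimodule_span_smult_sum:
  fixes k :: nat
  assumes "a \<in> semimodule_span G" "\<forall>i<k. u i \<in> G"
  shows "a + (\<Sum>i<k. l i *s u i) \<in> semimodule_span G"
  using assms(2)
proof (induction k)
  case 0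
  then show ?case using assms(1) by simp
next
  case (Suc k)
  then have "a + (\<Sum>i<k. l i *s u i) \<in> semimodule_span G" by simp
  then obtain m :: nat and l' u' where
    eq: "a + (\<Sum>i<k. l i *s u i) = (\<Sum>i<m. l' i *s u' i)" and in_G: "\<forall>i<m. u' i \<in> G"
    unfolding semimodule_span_def by blast
  \<comment> \<open>The new term goes to the first free index \<open>m\<close>; the updates leave
    all indices below \<open>m\<close> unchanged.\<close>
  have "a + (\<Sum>i<Suc k. l i *s u i) = (\<Sum>i<Suc m. (l'(m := l k)) i *s (u'(m := u k)) i)"
    by (simp add: eq add.assoc[symmetric])
  moreover have "\<forall>i<Suc m. (u'(m := u k)) i \<in> G"
    using in_G Suc.prems by (simp add: less_Suc_eq)
  ultimately show ?case unfolding semimodule_span_def by blast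
qed

lemma subsemimodule_span: "subsemimodule (semimodule_span G)"
proof -
  have zero: "0 \<in> semimodule_span G"
    unfolding semimodule_span_def by (auto intro!: exI[of _ "0::nat"])
  have smult: "c *s x \<in> semimodule_span G" if x: "x \<in> semimodule_span G" for c x
  proof -
    obtain k :: nat and l u where x: "x = (\<Sum>i<k. l i *s u i)" and u: "\<forall>i<k. u i \<in> G"
      using x unfolding semimodule_span_def by blast
    have "c *s x = (\<Sum>i<k. (c * l i) *s u i)"
      by (simp add: x smult_sum smult_smult)
    with u show ?thesis
      unfolding semimodule_span_def mem_Collect_eq
      by (intro exI[of _ k] exI[of _ "\<lambda>i. c * l i"] exI[of _ u]) simp
  qed
  have add: "x + y \<in> semimodule_span G"
    if x: "x \<in> semimodule_span G" and y: "y \<in> semimodule_span G" for x y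
  proof -
    obtain k :: nat and l u where "y = (\<Sum>i<k. l i *s u i)" "\<forall>i<k. u i \<in> G"
      using y unfolding semimodule_span_def by blast
    with semimodule_span_smult_sum[OF x] show ?thesis by simp
  qed
  show ?thesis
    unfolding subsemimodule_def using zero smult add by blast
qed

lemma semimodule_span_superset: "G \<subseteq> semimodule_span G"
proof
  fix x assume "x \<in> G"
  \<comment> \<open>A generator is the one-term combination with coefficient 1, added to the zero
    vector.\<close>
  then have "0 + (\<Sum>i<1::nat. 1 *s x) \<in> semimodule_span G"
    by (intro semimodule_span_smult_sum) (auto intro: subsemimodule_zero subsemimodule_span)
  then show "x \<in> semimodule_span G" by (simp add: smult_one)
qed

lemma rational_semimodule_iff:
  "rational_semimodule X \<longleftrightarrow> (\<exists>G. rational_subset G \<and> X = semimodule_span G)"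
  unfolding rational_semimodule_def using subsemimodule_span by blast

section \<open>Sums of semimodules\<close>

lemma subsemimodule_set_plus:
  assumes "subsemimodule X" "subsemimodule Y"
  shows "subsemimodule (X + Y)"
  unfolding subsemimodule_def
proof (intro conjI ballI allI)
  show "X + Y \<noteq> {}"
    using assms subsemimodule_zero by (blast intro: set_plus_intro)
next
  fix p q l m assume "p \<in> X + Y" "q \<in> X + Y"
  then obtain x y x' y' where "x \<in> X" "y \<in> Y" "x' \<in> X" "y' \<in> Y" "p = x + y" "q = x' + y'"
    by (blast elim: set_plus_elim)
  \<comment> \<open>Commutativity of addition collects the terms from \<open>X\<close> and those
    from \<open>Y\<close>.\<close>
  moreover from this have "l *s p + m *s q = (l *s x + m *s x') + (l *s y + m *s y')"
    by (simp add: smult_add_right ac_simps)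
  ultimately show "l *s p + m *s q \<in> X + Y"
    using assms unfolding subsemimodule_def by (metis set_plus_intro)
qed

text \<open>Minimality of spans gives both inclusions. Each generator lies in the sum because the
  other span contains 0; conversely, the span of the union contains both spans and is closed under
  addition.\<close>

lemma semimodule_span_Un:
  "semimodule_span (G \<union> H) = semimodule_span G + semimodule_span H"
proof
  have "x \<in> semimodule_span G + semimodule_span H" if "x \<in> G" for x
    using that semimodule_span_superset subsemimodule_zero[OF subsemimodule_span]
    by (metis add.right_neutral set_plus_intro subsetD)
  moreover have "x \<in> semimodule_span G + semimodule_span H" if "x \<in> H" for x
    using that semimodule_span_superset subsemimodule_zero[OF subsemimodule_span]
    by (metis add.left_neutral set_plus_intro subsetD)
  ultimately show "semimodule_span (G \<union> H) \<subseteq> semimodule_span G + semimodule_span H"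
    by (intro semimodule_span_minimal subsemimodule_set_plus subsemimodule_span) blast
next
  have "semimodule_span G \<subseteq> semimodule_span (G \<union> H)" "semimodule_span H \<subseteq> semimodule_span (G \<union> H)"
    using semimodule_span_superset[of "G \<union> H"]
    by (intro semimodule_span_minimal subsemimodule_span; simp)+
  then show "semimodule_span G + semimodule_span H \<subseteq> semimodule_span (G \<union> H)"
    by (auto elim!: set_plus_elim intro!: subsemimodule_add[OF subsemimodule_span])
qed

lemma rational_semimodule_set_plus:
  assumes "rational_semimodule X" "rational_semimodule Y"
  shows "rational_semimodule (X + Y)"
  using assms unfolding rational_semimodule_iff
  by (metis rational_union semimodule_span_Un)

lemma semimodule_span_image:
  fixes f :: "'a::{semiring_0, monoid_mult} ^ 'n \<Rightarrow> 'a ^ 'p"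
  assumes lin: "\<And>l m x y. f (l *s x + m *s y) = l *s f x + m *s f y"
  shows "semimodule_span (f ` G) = f ` semimodule_span G"
proof
  have "subsemimodule (f ` semimodule_span G)"
    using subsemimodule_span[of G] by (force simp: subsemimodule_def lin[symmetric])
  then show "semimodule_span (f ` G) \<subseteq> f ` semimodule_span G"
    by (intro semimodule_span_minimal image_mono semimodule_span_superset)
next
  let ?P = "f -` semimodule_span (f ` G)"
  \<comment> \<open>Linearity with both scalars 0; this makes the preimage nonempty.\<close>
  have "f 0 = 0"
    using lin[of 0 0 0 0] by (simp add: smult_zero_left)
  then have "0 \<in> ?P"
    using subsemimodule_zero[OF subsemimodule_span] by simp
  then have "subsemimodule ?P"
    using subsemimodule_span[of "f ` G"] by (auto simp: subsemimodule_def lin)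
  moreover have "G \<subseteq> ?P"
    using semimodule_span_superset[of "f ` G"] by blast
  ultimately show "f ` semimodule_span G \<subseteq> semimodule_span (f ` G)"
    using semimodule_span_minimal by blast
qed

section \<open>Concatenation of vectors\<close>

lemma vec_append_nth [simp]:
  "vec_append x z $ Inl j = x $ j" "vec_append x z $ Inr k = z $ k"
  by (simp_all add: vec_append_def)

lemma vec_append_eqI:
  "(\<And>j. v $ Inl j = w $ Inl j) \<Longrightarrow> (\<And>k. v $ Inr k = w $ Inr k) \<Longrightarrow> v = w"
  by (metis vec_eq_iff sum.exhaust)

text \<open>Two embeddings share the work: \<open>?h\<close> pads with 1 and is a monoid morphism,
  so it carries rationality; \<open>?f\<close> pads with 0 and is linear, so it carries spans.
  Multiplying by \<open>vec_append 1 0\<close> turns the first into the second.\<close>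

lemma rational_semimodule_vec_append_left:
  fixes X :: "('a::{semiring_0, monoid_mult} ^ 'n) set"
  assumes "rational_semimodule X"
  shows "rational_semimodule ((\<lambda>x. vec_append x (0 :: 'a ^ 'p)) ` X)"
proof -
  let ?f = "\<lambda>x::'a ^ 'n. vec_append x (0 :: 'a ^ 'p)"
  let ?h = "\<lambda>x::'a ^ 'n. vec_append x (1 :: 'a ^ 'p)"
  obtain G where G: "rational_subset G" "X = semimodule_span G"
    using assms rational_semimodule_iff by blast
  have "rational_subset (?h ` G)"
    by (rule rational_subset_image[OF G(1)]) (auto intro!: vec_append_eqI)
  then have "rational_subset (?h ` G * {vec_append 1 0})"
    by (rule rational_product) (simp add: rational_finite)
  moreover have "?h x * vec_append 1 0 = ?f x" for x
    by (auto intro!: vec_append_eqI)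
  then have "?h ` G * {vec_append 1 0} = ?f ` G"
    by (force simp: set_times_def)
  moreover have "semimodule_span (?f ` G) = ?f ` X"
    unfolding G(2) by (rule semimodule_span_image) (auto intro!: vec_append_eqI)
  ultimately show ?thesis unfolding rational_semimodule_iff by metis
qed

text \<open>Mirror image of the previous argument: the padding sits in the first block, and
  \<open>vec_append 0 1\<close> erases it.\<close>

lemma rational_semimodule_vec_append_right:
  fixes Z :: "('a::{semiring_0, monoid_mult} ^ 'p) set"
  assumes "rational_semimodule Z"
  shows "rational_semimodule (vec_append (0 :: 'a ^ 'n) ` Z)"
proof -
  let ?f = "vec_append (0 :: 'a ^ 'n) :: 'a ^ 'p \<Rightarrow> _"
  let ?h = "vec_append (1 :: 'a ^ 'n) :: 'a ^ 'p \<Rightarrow> _"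
  obtain G where G: "rational_subset G" "Z = semimodule_span G"
    using assms rational_semimodule_iff by blast
  have "rational_subset (?h ` G)"
    by (rule rational_subset_image[OF G(1)]) (auto intro!: vec_append_eqI)
  then have "rational_subset (?h ` G * {vec_append 0 1})"
    by (rule rational_product) (simp add: rational_finite)
  moreover have "?h x * vec_append 0 1 = ?f x" for x
    by (auto intro!: vec_append_eqI)
  then have "?h ` G * {vec_append 0 1} = ?f ` G"
    by (force simp: set_times_def)
  moreover have "semimodule_span (?f ` G) = ?f ` Z"
    unfolding G(2) by (rule semimodule_span_image) (auto intro!: vec_append_eqI)
  ultimately show ?thesis unfolding rational_semimodule_iff by metis
qed

theorem theorem3p2:
  fixes X Y :: "('a::{semiring_0, monoid_mult} ^ 'n) set"
    and Z :: "('a ^ 'p) set"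
  assumes "rational_semimodule X" and "rational_semimodule Y" and "rational_semimodule Z"
  shows "rational_semimodule {x + y | x y. x \<in> X \<and> y \<in> Y}
       \<and> rational_semimodule {vec_append x z | x z. x \<in> X \<and> z \<in> Z}"
proof
  have "{x + y | x y. x \<in> X \<and> y \<in> Y} = X + Y"
    by (auto simp: set_plus_def)
  then show "rational_semimodule {x + y | x y. x \<in> X \<and> y \<in> Y}"
    using rational_semimodule_set_plus assms by simp
next
  have split: "vec_append x z = vec_append x 0 + vec_append 0 z"
    for x :: "'a ^ 'n" and z :: "'a ^ 'p"
    by (auto intro!: vec_append_eqI)
  have "{vec_append x z | x z. x \<in> X \<and> z \<in> Z}
      = (\<lambda>x. vec_append x 0) ` X + vec_append 0 ` Z"
    unfolding set_plus_def by (subst split) blast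
  then show "rational_semimodule {vec_append x z | x z. x \<in> X \<and> z \<in> Z}"
    using rational_semimodule_set_plus assms rational_semimodule_vec_append_left
      rational_semimodule_vec_append_right by metis
qed

end
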